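(* Let $d\ge1$ be an integer, let $\lambda_{(l)}=l(l+d-1)$, $l\in\mathbb{N}=\{0,1,2,\dots\}$, be the energy levels of the Laplacian on $\mathbb{S}^d$, and let $\tilde\lambda_{(l)}=l(l+d-1)+\frac{d^2}{4}$ be the shifted energy levels. Then $$ L_{0,d}^{class}|\mathbb{S}^d|=\sum_{l\ge0}\frac{2l+d}{d}\binom{d+l-1}{d-1}\left(\tilde\lambda_{(l+1)}^{-d/2}-\tilde\lambda_{(l)}^{-d/2}+\frac d4\left(\tilde\lambda_{(l+1)}^{-1-d/2}+\tilde\lambda_{(l)}^{-1-d/2}\right)\left(\lambda_{(l+1)}-\lambda_{(l)}\right)\right). $$
   Context: $\mathbb{S}^d$ is the round unit sphere in $\mathbb{R}^{d+1}$ and $|\mathbb{S}^d|$ its measure. The semiclassical constant is $L_{\gamma,d}^{class}=(4\pi)^{-d/2}\frac{\Gamma(\gamma+1)}{\Gamma(\gamma+1+d/2)}$, so $L_{0,d}^{class}|\mathbb{S}^d|=\frac{2}{d!}$. *)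

theory Defs
  imports "HOL-Analysis.Analysis"
begin

definition L_class :: "real \<Rightarrow> nat \<Rightarrow> real" where
  "L_class \<gamma> d = (4 * pi) powr (- real d / 2) * (Gamma (\<gamma> + 1) / Gamma (\<gamma> + 1 + real d / 2))"

(* The round surface measure on the unit sphere, as in polar coordinates: a Borel set E has
   measure n * vol {x. 0 < |x| <= 1 and x/|x| in E}, where n is the dimension of the ambient
   space.  For x \<noteq> 0, sgn x = x/|x|. *)
definition sphere_measure :: "'a::euclidean_space measure" where
  "sphere_measure =
     scale_measure (of_nat DIM('a))
       (distr (restrict_space lborel (cball 0 1 - {0})) (restrict_space borel (sphere 0 1)) sgn)"

definition energy_level :: "nat \<Rightarrow> nat \<Rightarrow> real" where
  "energy_level d l = real l * (real l + real d - 1)"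

definition shifted_energy_level :: "nat \<Rightarrow> nat \<Rightarrow> real" where
  "shifted_energy_level d l = energy_level d l + (real d)\<^sup>2 / 4"

end

theory Submission
  imports Defs "HOL-Real_Asymp.Real_Asymp"
begin

text \<open>
  Write \<open>N\<^sub>l = (2l+d)/d * binom(d+l-1, d-1)\<close> for the number of eigenvalues (counted with
  multiplicity) up to the level \<open>l\<close>, \<open>x\<^sub>l\<close> for the shifted energy level and
  \<open>f(x) = x\<close> to the power \<open>-d/2\<close>. Since \<open>-f'(x) = d/2 * f(x)/x\<close>, the summand is
  \<open>N\<^sub>l\<close> times the error of the trapezoidal rule for the integral of \<open>f'\<close>
  over the gap from \<open>x\<^sub>l\<close> to \<open>x\<^sub>l\<^sub>+\<^sub>1\<close>, whose length is \<open>2l+d\<close>.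

  The shift \<open>d\<^sup>2/4\<close> is exactly the one for which the series telescopes. Collect the terms of
  the partial sum that contain \<open>x\<^sub>l\<close> (summation by parts): their sum is a multiple of
  \<open>-(N\<^sub>l - N\<^sub>l\<^sub>-\<^sub>1) x\<^sub>l + d/4 ((2l+d) N\<^sub>l + (2l+d-2) N\<^sub>l\<^sub>-\<^sub>1)\<close>, and this vanishes for
  every \<open>l\<close>, where \<open>N\<^sub>l\<^sub>-\<^sub>1\<close> is read as \<open>0\<close> for \<open>l = 0\<close>. The latter is a polynomial identity, lemma \<open>level_multiplicity_times_shifted_level\<close>.
  Hence a partial sum equals its boundary term,
  \<open>N\<^sub>l f(x\<^sub>l\<^sub>+\<^sub>1) + d/4 N\<^sub>l (2l+d) f(x\<^sub>l\<^sub>+\<^sub>1)/x\<^sub>l\<^sub>+\<^sub>1\<close>, see lemma \<open>trapezoidal_partial_sum\<close>.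
  As \<open>N\<^sub>l\<close> is asymptotic to \<open>2 l^d / d!\<close> and \<open>x\<^sub>l\<close> to \<open>l\<^sup>2\<close>, the first part tends to
  \<open>2/d!\<close> and the second, being smaller by a factor of order \<open>1/l\<close>, tends to zero.

  It remains to identify \<open>2/d!\<close> with the semiclassical constant times the area of the sphere.
  The area is \<open>d+1\<close> times the volume of the unit ball, and the product of the two Gamma values
  that occur is given by the duplication formula at half-integers.
\<close>

section \<open>The counting function of the levels\<close>

text \<open>
  This is the dimension of the space of spherical harmonics of degree at most \<open>l\<close> on the
  \<open>d\<close>-sphere, in the closed form \<open>binom(d+l, d) + binom(d+l-1, d)\<close> rewritten with a single
  binomial coefficient.
\<close>
definition level_count :: "nat \<Rightarrow> nat \<Rightarrow> real" where
  "level_count d l = (2 * real l + real d) / real d * real ((d + l - 1) choose (d - 1))"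

lemma shifted_energy_level_pos:
  assumes "d \<ge> 1"
  shows "shifted_energy_level d l > 0"
proof -
  have "energy_level d l \<ge> 0"
    using assms by (simp add: energy_level_def)
  moreover have "(real d)\<^sup>2 / 4 > 0"
    using assms by simp
  ultimately show ?thesis
    unfolding shifted_energy_level_def by linarith
qed

lemma shifted_energy_level_Suc:
  "shifted_energy_level d (Suc l) = (real l + 1) * (real l + real d) + (real d)\<^sup>2 / 4"
  by (simp add: shifted_energy_level_def energy_level_def algebra_simps)

lemma energy_gap: "energy_level d (Suc l) - energy_level d l = 2 * real l + real d"
  by (simp add: energy_level_def algebra_simps)

text \<open>
  Both counts have a common factor \<open>t\<close>, by the ratio of consecutive binomial coefficients; after
  cancelling it, a polynomial identity in \<open>l\<close> and \<open>d\<close> remains, and \<open>d\<^sup>2/4\<close> is the only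
  shift of the energy for which it holds.
\<close>
lemma level_multiplicity_times_shifted_level:
  assumes "d \<ge> 1"
  shows "(level_count d (Suc l) - level_count d l) * shifted_energy_level d (Suc l) =
         real d / 4 * (level_count d (Suc l) * (2 * real (Suc l) + real d)
                       + level_count d l * (2 * real l + real d))"
proof -
  obtain k where d: "d = Suc k"
    using assms by (cases d) auto
  define L where "L = real l + 1"
  \<comment> \<open>The coefficients \<open>binom(k+l, k)\<close> and \<open>binom(k+l+1, k)\<close> are \<open>L\<close> and \<open>d+L-1\<close> times \<open>t\<close>.\<close>
  define t where "t = real ((k + l) choose k) / L"
  have L: "L > 0"
    by (simp add: L_def)
  have C0: "real ((d + l - 1) choose (d - 1)) = L * t"
    using L by (simp add: t_def d)
  have "Suc (k + l) * ((k + l) choose l) = (Suc (k + l) choose Suc l) * Suc l"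
    by (rule Suc_times_binomial_eq)
  moreover have "(k + l) choose l = (k + l) choose k"
    using binomial_symmetric[of k "k + l"] by simp
  moreover have "Suc (k + l) choose Suc l = Suc (k + l) choose k"
    using binomial_symmetric[of k "Suc (k + l)"] by simp
  ultimately have "Suc (k + l) * ((k + l) choose k) = (Suc (k + l) choose k) * Suc l"
    by simp
  hence "real (Suc (k + l)) * real ((k + l) choose k) = real (Suc (k + l) choose k) * real (Suc l)"
    by (simp only: of_nat_mult[symmetric])
  moreover have "real (Suc (k + l)) = real d + L - 1" "real (Suc l) = L"
    by (simp_all add: d L_def)
  ultimately have "(real d + L - 1) * real ((k + l) choose k) = real (Suc (k + l) choose k) * L"
    by (simp only:)
  hence C1: "real ((d + Suc l - 1) choose (d - 1)) = (real d + L - 1) * t"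
    using L by (simp add: t_def d field_simps)
  have N1: "level_count d (Suc l) = (2 * L + real d) / real d * ((real d + L - 1) * t)"
    unfolding level_count_def C1 by (simp add: L_def)
  have N0: "level_count d l = (2 * L + real d - 2) / real d * (L * t)"
    unfolding level_count_def C0 by (simp add: L_def)
  have x: "shifted_energy_level d (Suc l) = L * (L + real d - 1) + (real d)\<^sup>2 / 4"
    by (simp add: shifted_energy_level_Suc L_def)
  have poly: "((2 * L + D) * (D + L - 1) - (2 * L + D - 2) * L) * (L * (L + D - 1) + D\<^sup>2 / 4)
      = D / 4 * ((2 * L + D)\<^sup>2 * (D + L - 1) + (2 * L + D - 2)\<^sup>2 * L)" for D :: real
    by algebra
  have factor: "A / D * (P * t) - B / D * (Q * t) = t / D * (A * P - B * Q)" for A B D P Q :: real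
    by (simp add: right_diff_distrib mult_ac)
  have regroup: "t / D * (D / 4 * (A\<^sup>2 * P + B\<^sup>2 * Q))
      = D / 4 * (A / D * (P * t) * A + B / D * (Q * t) * B)" for A B D P Q :: real
    by (simp add: power2_eq_square distrib_left mult_ac add_divide_distrib)
  have "level_count d (Suc l) - level_count d l =
        t / real d * ((2 * L + real d) * (real d + L - 1) - (2 * L + real d - 2) * L)"
    unfolding N0 N1 by (rule factor)
  hence "(level_count d (Suc l) - level_count d l) * shifted_energy_level d (Suc l) =
        t / real d * (((2 * L + real d) * (real d + L - 1) - (2 * L + real d - 2) * L)
                      * (L * (L + real d - 1) + (real d)\<^sup>2 / 4))"
    by (simp only: x mult.assoc)
  also have "\<dots> = t / real d * (real d / 4 * ((2 * L + real d)\<^sup>2 * (real d + L - 1)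
                                            + (2 * L + real d - 2)\<^sup>2 * L))"
    by (simp only: poly)
  also have "\<dots> = real d / 4 * (level_count d (Suc l) * (2 * L + real d)
                              + level_count d l * (2 * L + real d - 2))"
    unfolding N0 N1 by (rule regroup)
  finally show ?thesis
    by (simp add: L_def)
qed

section \<open>Telescoping\<close>

definition trapezoidal_term :: "nat \<Rightarrow> nat \<Rightarrow> real" where
  "trapezoidal_term d l = level_count d l *
     (shifted_energy_level d (l + 1) powr (- real d / 2)
      - shifted_energy_level d l powr (- real d / 2)
      + real d / 4 *
        (shifted_energy_level d (l + 1) powr (- 1 - real d / 2)
         + shifted_energy_level d l powr (- 1 - real d / 2)) *
        (energy_level d (l + 1) - energy_level d l))"

lemma powr_shift_exponent:
  fixes x :: real
  assumes "x > 0"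
  shows "x powr (- 1 - real d / 2) = x powr (- real d / 2) / x"
proof -
  have "- 1 - real d / 2 = - real d / 2 - 1"
    by simp
  hence "x powr (- 1 - real d / 2) = x powr (- real d / 2) / x powr 1"
    by (simp only: powr_diff)
  thus ?thesis
    using assms by simp
qed

text \<open>
  Adding the next summand replaces the boundary term at one level by that at the following level;
  the contributions of the level in between cancel because of
  \<open>level_multiplicity_times_shifted_level\<close>. For the very first level, where nothing precedes, the
  cancellation is the identity \<open>d\<^sup>2/4 = d/4 * d\<close>.
\<close>
lemma trapezoidal_partial_sum:
  assumes "d \<ge> 1"
  shows "(\<Sum>l<Suc n. trapezoidal_term d l) =
         level_count d n * shifted_energy_level d (Suc n) powr (- real d / 2) *
           (1 + real d / 4 * ((2 * real n + real d) / shifted_energy_level d (Suc n)))"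
proof -
  let ?x = "shifted_energy_level d"
  let ?f = "\<lambda>l. ?x l powr (- real d / 2)"
  have x0: "?x l \<noteq> 0" for l
    using shifted_energy_level_pos[OF assms, of l] by simp
  have "trapezoidal_term d l = level_count d l *
          (?f (Suc l) - ?f l + real d / 4 * (?f (Suc l) / ?x (Suc l) + ?f l / ?x l)
           * (2 * real l + real d))" for l
    unfolding trapezoidal_term_def
    using shifted_energy_level_pos[OF assms] by (simp add: powr_shift_exponent energy_gap)
  hence term_split: "trapezoidal_term d l =
       level_count d l * ?f (Suc l) * (1 + real d / 4 * ((2 * real l + real d) / ?x (Suc l)))
       - level_count d l * ?f l * (1 - real d / 4 * ((2 * real l + real d) / ?x l))" for l
    by (simp add: algebra_simps add_divide_distrib)
  show ?thesis
  proof (induction n)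
    case 0
    have "?x 0 = real d / 4 * real d"
      by (simp add: shifted_energy_level_def energy_level_def power2_eq_square)
    hence one: "real d / 4 * ((2 * real 0 + real d) / ?x 0) = 1"
      using x0[of 0] by simp
    have "(\<Sum>l<Suc 0. trapezoidal_term d l) = trapezoidal_term d 0"
      by simp
    thus ?case
      unfolding term_split[of 0] one by (simp only: diff_self mult_zero_right diff_zero)
  next
    case (Suc n)
    let ?g0 = "2 * real n + real d" and ?g1 = "2 * real (Suc n) + real d"
    let ?N0 = "level_count d n" and ?N1 = "level_count d (Suc n)"
    have "(?N1 - ?N0) * ?x (Suc n) = real d / 4 * (?N1 * ?g1 + ?N0 * ?g0)"
      by (rule level_multiplicity_times_shifted_level[OF assms])
    hence "?N1 - ?N0 = real d / 4 * (?N1 * ?g1 + ?N0 * ?g0) / ?x (Suc n)"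
      using x0[of "Suc n"] by (simp add: eq_divide_eq)
    hence "?N0 * (1 + real d / 4 * (?g0 / ?x (Suc n)))
         = ?N1 * (1 - real d / 4 * (?g1 / ?x (Suc n)))"
      by (simp add: algebra_simps add_divide_distrib)
    hence cancel: "?N0 * ?f (Suc n) * (1 + real d / 4 * (?g0 / ?x (Suc n)))
                 = ?N1 * ?f (Suc n) * (1 - real d / 4 * (?g1 / ?x (Suc n)))"
      by (simp only: mult.commute[of _ "?f (Suc n)"] mult.assoc)
    have "(\<Sum>l<Suc (Suc n). trapezoidal_term d l) =
          (\<Sum>l<Suc n. trapezoidal_term d l) + trapezoidal_term d (Suc n)"
      by (rule sum.lessThan_Suc)
    thus ?case
      unfolding Suc.IH term_split[of "Suc n"] cancel by (simp only: add_diff_eq add_diff_cancel_left')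
  qed
qed

section \<open>Asymptotics of the boundary term\<close>

lemma binomial_asymptotics:
  "(\<lambda>l. real ((k + l) choose k) / real l ^ k) \<longlonglongrightarrow> 1 / fact k"
proof (induction k)
  case 0
  show ?case by simp
next
  case (Suc k)
  have "(\<lambda>l. (real l + real k + 1) / real l) \<longlonglongrightarrow> 1"
    by real_asymp
  hence "(\<lambda>l. real ((k + l) choose k) / real l ^ k * ((real l + real k + 1) / real l / real (Suc k)))
          \<longlonglongrightarrow> 1 / fact k * (1 / real (Suc k))"
    by (intro tendsto_mult Suc.IH tendsto_divide tendsto_const) auto
  moreover have "real ((k + l) choose k) / real l ^ k * ((real l + real k + 1) / real l / real (Suc k))
                 = real ((Suc k + l) choose Suc k) / real l ^ Suc k" for l
  proof -
    have "Suc (k + l) * ((k + l) choose k) = (Suc (k + l) choose Suc k) * Suc k"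
      by (rule Suc_times_binomial_eq)
    hence "real (Suc (k + l)) * real ((k + l) choose k)
           = real (Suc (k + l) choose Suc k) * real (Suc k)"
      by (simp only: of_nat_mult[symmetric])
    hence "real (Suc k + l choose Suc k)
           = real ((k + l) choose k) * (real l + real k + 1) / real (Suc k)"
      by (simp add: eq_divide_eq algebra_simps del: binomial_Suc_Suc)
    thus ?thesis
      by (simp add: mult_ac del: binomial_Suc_Suc)
  qed
  ultimately show ?case
    by (simp add: mult.commute del: binomial_Suc_Suc)
qed

lemma level_count_asymptotics:
  assumes "d \<ge> 1"
  shows "(\<lambda>l. level_count d l / real l ^ d) \<longlonglongrightarrow> 2 / fact d"
proof -
  obtain k where d: "d = Suc k"
    using assms by (cases d) auto
  have "(\<lambda>l. (2 * real l + real d) / real l) \<longlonglongrightarrow> 2"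
    by real_asymp
  hence "(\<lambda>l. (2 * real l + real d) / real l / real d * (real ((k + l) choose k) / real l ^ k))
          \<longlonglongrightarrow> 2 / real d * (1 / fact k)"
    using assms by (intro tendsto_mult binomial_asymptotics tendsto_divide tendsto_const) auto
  moreover have "(2 * real l + real d) / real l / real d * (real ((k + l) choose k) / real l ^ k)
                 = level_count d l / real l ^ d" for l
    by (simp add: level_count_def d)
  ultimately show ?thesis
    by (simp add: d)
qed

lemma shifted_energy_level_powr_asymptotics:
  "(\<lambda>l. shifted_energy_level d (Suc l) powr (- real d / 2) * real l ^ d) \<longlonglongrightarrow> 1"
proof -
  have "(\<lambda>l. ((real l + 1) * (real l + real d) + (real d)\<^sup>2 / 4) / real l ^ 2) \<longlonglongrightarrow> 1"
    by real_asymp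
  hence "(\<lambda>l. (shifted_energy_level d (Suc l) / real l ^ 2) powr (- real d / 2))
           \<longlonglongrightarrow> 1 powr (- real d / 2)"
    unfolding shifted_energy_level_Suc by (intro tendsto_powr tendsto_const) auto
  moreover have "\<forall>\<^sub>F l in sequentially.
      (shifted_energy_level d (Suc l) / real l ^ 2) powr (- real d / 2)
      = shifted_energy_level d (Suc l) powr (- real d / 2) * real l ^ d"
    using eventually_gt_at_top[of 0]
  proof eventually_elim
    case (elim l)
    have "(real l ^ 2) powr (- real d / 2) = (real l powr 2) powr (- real d / 2)"
      using elim by (simp add: powr_numeral)
    also have "\<dots> = real l powr (- real d)"
      by (simp only: powr_powr) simp
    also have "\<dots> = 1 / real l ^ d"
      using elim by (simp add: powr_minus powr_realpow divide_inverse)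
    finally have "(real l ^ 2) powr (- real d / 2) = 1 / real l ^ d" .
    moreover have "shifted_energy_level d (Suc l) \<ge> 0"
      by (simp add: shifted_energy_level_Suc)
    ultimately show ?case
      using elim by (simp add: powr_divide)
  qed
  ultimately have "(\<lambda>l. shifted_energy_level d (Suc l) powr (- real d / 2) * real l ^ d)
                     \<longlonglongrightarrow> 1 powr (- real d / 2)"
    by (rule Lim_transform_eventually)
  thus ?thesis
    by simp
qed

lemma trapezoidal_series:
  assumes "d \<ge> 1"
  shows "trapezoidal_term d sums (2 / fact d)"
proof -
  let ?x = "shifted_energy_level d"
  have "(\<lambda>n. (level_count d n / real n ^ d) * (?x (Suc n) powr (- real d / 2) * real n ^ d))
          \<longlonglongrightarrow> 2 / fact d * 1"
    by (intro tendsto_mult level_count_asymptotics[OF assms]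
        shifted_energy_level_powr_asymptotics)
  moreover have "\<forall>\<^sub>F n in sequentially.
      (level_count d n / real n ^ d) * (?x (Suc n) powr (- real d / 2) * real n ^ d)
      = level_count d n * ?x (Suc n) powr (- real d / 2)"
    using eventually_gt_at_top[of 0] by eventually_elim simp
  ultimately have "(\<lambda>n. level_count d n * ?x (Suc n) powr (- real d / 2)) \<longlonglongrightarrow> 2 / fact d * 1"
    by (rule Lim_transform_eventually)
  hence main: "(\<lambda>n. level_count d n * ?x (Suc n) powr (- real d / 2)) \<longlonglongrightarrow> 2 / fact d"
    by simp
  have gap: "(\<lambda>n. (2 * real n + real d) / ?x (Suc n)) \<longlonglongrightarrow> 0"
    unfolding shifted_energy_level_Suc by real_asymp
  have "(\<lambda>n. level_count d n * ?x (Suc n) powr (- real d / 2) *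
             (1 + real d / 4 * ((2 * real n + real d) / ?x (Suc n))))
          \<longlonglongrightarrow> 2 / fact d * (1 + real d / 4 * 0)"
    by (intro tendsto_mult tendsto_add tendsto_const main gap)
  hence "(\<lambda>n. \<Sum>l<Suc n. trapezoidal_term d l) \<longlonglongrightarrow> 2 / fact d"
    by (simp only: trapezoidal_partial_sum[OF assms] mult_zero_right add_0_right mult_1_right)
  thus ?thesis
    unfolding sums_def by (rule LIMSEQ_imp_Suc[of "\<lambda>n. sum (trapezoidal_term d) {..<n}"])
qed

section \<open>The semiclassical constant\<close>

text \<open>
  The preimage of the whole sphere under \<open>sgn\<close> is the punctured unit ball, and the puncture is a
  null set.
\<close>
lemma measure_sphere:
  "measure (sphere_measure :: 'a::euclidean_space measure) (sphere 0 1)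
   = real DIM('a) * unit_ball_vol (real DIM('a))"
proof -
  let ?B = "cball (0::'a) 1 - {0}"
  let ?S = "restrict_space borel (sphere (0::'a) 1)"
  have meas: "sgn \<in> measurable (restrict_space lborel ?B) ?S"
  proof (rule measurable_restrict_space2)
    show "sgn \<in> space (restrict_space lborel ?B) \<rightarrow> sphere 0 1"
      by (auto simp: space_restrict_space norm_sgn)
    show "sgn \<in> borel_measurable (restrict_space lborel ?B)"
      by (intro measurable_restrict_space1) simp
  qed
  have preimage: "sgn -` sphere 0 1 \<inter> space (restrict_space lborel ?B) = ?B"
    by (auto simp: space_restrict_space norm_sgn)
  have S: "sphere (0::'a) 1 \<in> sets ?S"
    by (simp add: sets_restrict_space_iff)
  have "emeasure (distr (restrict_space lborel ?B) ?S sgn) (sphere 0 1)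
        = emeasure (restrict_space lborel ?B) ?B"
    by (simp only: emeasure_distr[OF meas S] preimage)
  also have "\<dots> = emeasure lborel ?B"
    by (subst emeasure_restrict_space) auto
  also have "\<dots> = emeasure lborel (cball (0::'a) 1)"
    by (intro emeasure_Diff_null_set) auto
  also have "\<dots> = ennreal (unit_ball_vol (real DIM('a)))"
    by (simp add: emeasure_cball)
  finally have "emeasure (sphere_measure :: 'a measure) (sphere 0 1)
                = of_nat DIM('a) * ennreal (unit_ball_vol (real DIM('a)))"
    by (simp add: sphere_measure_def)
  also have "\<dots> = ennreal (real DIM('a) * unit_ball_vol (real DIM('a)))"
    by (simp add: ennreal_mult ennreal_of_nat_eq_real_of_nat)
  finally show ?thesis
    by (simp add: measure_def)
qed

text \<open>
  This is Legendre's duplication formula at \<open>1 + d/2\<close>. At half-integers it follows by induction,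
  since raising \<open>d\<close> by one exchanges the two factors up to one application of the functional
  equation.
\<close>
lemma Gamma_duplication_half_integer:
  "Gamma (1 + real d / 2) * Gamma ((real d + 1) / 2 + 1) = sqrt pi * fact (d + 1) / 2 ^ (d + 1)"
proof (induction d)
  case 0
  have "Gamma (1 / 2 + 1 :: real) = 1 / 2 * Gamma (1 / 2)"
    by (rule Gamma_plus1) (auto dest: nonpos_Ints_nonpos)
  thus ?case
    by (simp add: Gamma_one_half_real)
next
  case (Suc d)
  have "Gamma (1 + real d / 2 + 1) = (1 + real d / 2) * Gamma (1 + real d / 2)"
    by (rule Gamma_plus1) (auto dest: nonpos_Ints_nonpos)
  moreover have "(real (Suc d) + 1) / 2 + 1 = 1 + real d / 2 + 1"
    and "1 + real (Suc d) / 2 = (real d + 1) / 2 + 1"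
    by (simp_all add: field_simps)
  ultimately have "Gamma (1 + real (Suc d) / 2) * Gamma ((real (Suc d) + 1) / 2 + 1)
      = Gamma ((real d + 1) / 2 + 1) * ((1 + real d / 2) * Gamma (1 + real d / 2))"
    by (simp only:)
  also have "\<dots> = (1 + real d / 2) * (Gamma (1 + real d / 2) * Gamma ((real d + 1) / 2 + 1))"
    by simp
  also have "\<dots> = (1 + real d / 2) * (sqrt pi * fact (d + 1) / 2 ^ (d + 1))"
    by (simp only: Suc.IH)
  also have "\<dots> = sqrt pi * fact (Suc d + 1) / 2 ^ (Suc d + 1)"
    by (simp add: field_simps)
  finally show ?case .
qed

lemma semiclassical_constant_times_sphere_area:
  "L_class 0 d * (real (d + 1) * unit_ball_vol (real (d + 1))) = 2 / fact d"
proof -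
  let ?G = "Gamma (1 + real d / 2) * Gamma ((real d + 1) / 2 + 1)"
  have "(4 * pi) powr (- real d / 2) * pi powr ((real d + 1) / 2)
        = 4 powr (- real d / 2) * (pi powr (- real d / 2) * pi powr ((real d + 1) / 2))"
    by (simp add: powr_mult)
  also have "pi powr (- real d / 2) * pi powr ((real d + 1) / 2) = pi powr (1 / 2)"
    by (simp add: powr_add[symmetric] add_divide_distrib)
  also have "\<dots> = sqrt pi"
    by (simp add: powr_half_sqrt)
  also have "(4::real) powr (- real d / 2) = (2 powr 2) powr (- real d / 2)"
    by (simp add: powr_numeral)
  also have "\<dots> = 2 powr (- real d)"
    by (simp only: powr_powr) simp
  also have "\<dots> = 1 / 2 ^ d"
    by (simp add: powr_minus powr_realpow divide_inverse)
  finally have powers: "(4 * pi) powr (- real d / 2) * pi powr ((real d + 1) / 2) = sqrt pi / 2 ^ d"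
    by simp
  have "L_class 0 d * (real (d + 1) * unit_ball_vol (real (d + 1)))
        = real (d + 1) * ((4 * pi) powr (- real d / 2) * pi powr ((real d + 1) / 2)) / ?G"
    by (simp add: L_class_def unit_ball_vol_def add.commute)
  also have "\<dots> = real (d + 1) * (sqrt pi / 2 ^ d) / (sqrt pi * fact (d + 1) / 2 ^ (d + 1))"
    by (simp only: powers Gamma_duplication_half_integer)
  also have "\<dots> = 2 / fact d"
  proof -
    have cancel: "r * (s / p) / (s * (r * F) / (2 * p)) = 2 / F"
      if "r \<noteq> 0" "s \<noteq> 0" "p \<noteq> 0" for r s p F :: real
      using that by simp
    have "(fact (d + 1) :: real) = real (d + 1) * fact d" and "(2::real) ^ (d + 1) = 2 * 2 ^ d"
      by simp_all
    thus ?thesis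
      by (simp only:) (rule cancel; simp)
  qed
  finally show ?thesis .
qed

theorem theorem7p1p2:
  fixes d :: nat
  assumes "d \<ge> 1"
    and "CARD('n::finite) = d + 1"
  shows "(\<lambda>l. (2 * real l + real d) / real d * real ((d + l - 1) choose (d - 1)) *
            (shifted_energy_level d (l + 1) powr (- real d / 2)
             - shifted_energy_level d l powr (- real d / 2)
             + real d / 4 *
               (shifted_energy_level d (l + 1) powr (- 1 - real d / 2)
                + shifted_energy_level d l powr (- 1 - real d / 2)) *
               (energy_level d (l + 1) - energy_level d l)))
         sums (L_class 0 d * measure (sphere_measure :: (real ^ 'n) measure) (sphere 0 1))"
proof -
  have "L_class 0 d * measure (sphere_measure :: (real ^ 'n) measure) (sphere 0 1) = 2 / fact d"
    using semiclassical_constant_times_sphere_area[of d] assms(2) by (simp add: measure_sphere)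
  thus ?thesis
    using trapezoidal_series[OF assms(1)]
    by (simp add: trapezoidal_term_def[abs_def] level_count_def)
qed

end
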